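(* Let $\pi$ be a prior density satisfying the regularity conditions stated in the context, with associated constant $\epsilon_\pi\in(0,1)$. In the one-sided unbounded forecasting game, for any $C\in(0,\min(\epsilon_\pi,1/2))$, whenever $0<S_n/A_n^2<C/2$, $$\mathcal K_n^\pi\ \ge\ \frac{\sqrt C}{6}\,\frac{S_n}{A_n^2}\,\pi\!\left(\frac{S_n}{A_n^2}\right)\exp\!\left(\frac{(1-2C)S_n^2}{2A_n^2}\right).$$
   Context: In the one-sided unbounded forecasting game Reality's moves are $x_1,x_2,\dots\in[-1,\infty)$. Put $S_n=x_1+\dots+x_n$ and $A_n^2=x_1^2+\dots+x_n^2$ with $A_n\ge0$. The Bayesian strategy with prior density $\pi$ has capital process $$\mathcal K_n^\pi=\int_0^1\prod_{i=1}^n(1+\epsilon x_i)\,\pi(\epsilon)\,d\epsilon .$$ Regularity conditions on $\pi$: there exist $\epsilon_\pi\in(0,1)$ and $\delta_\pi>0$ such that (1) $\pi$ is nonnegative and integrable on $[0,1]$ (its integral need not be $1$); (2) $\pi(\epsilon)\ge\delta_\pi$ on $(0,\epsilon_\pi)$; (3) $\epsilon\pi(\epsilon)$ is increasing (i.e. nondecreasing) on $(0,\epsilon_\pi)$. *)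

theory Defs
  imports "HOL-Analysis.Analysis"
begin

text \<open>Reality's moves are \<open>x 1, x 2, \<dots>\<close>; the value \<open>x 0\<close> is never used.\<close>

definition one_sided_path :: "(nat \<Rightarrow> real) \<Rightarrow> bool" where
  "one_sided_path x \<longleftrightarrow> (\<forall>i\<ge>1. x i \<in> {-1..})"

definition S :: "(nat \<Rightarrow> real) \<Rightarrow> nat \<Rightarrow> real" where
  "S x n = (\<Sum>i=1..n. x i)"

definition A :: "(nat \<Rightarrow> real) \<Rightarrow> nat \<Rightarrow> real" where
  "A x n = sqrt (\<Sum>i=1..n. (x i)\<^sup>2)"

text \<open>Integrability and integrals are in the sense of Lebesgue, with respect to the completed
  measure, so that a prior need not be Borel measurable.\<close>

definition bayes_capital :: "(real \<Rightarrow> real) \<Rightarrow> (nat \<Rightarrow> real) \<Rightarrow> nat \<Rightarrow> real" where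
  "bayes_capital \<pi> x n = (LINT \<epsilon>:{0..1}|lebesgue. (\<Prod>i=1..n. 1 + \<epsilon> * x i) * \<pi> \<epsilon>)"

definition regular_prior :: "(real \<Rightarrow> real) \<Rightarrow> real \<Rightarrow> real \<Rightarrow> bool" where
  "regular_prior \<pi> \<epsilon>\<^sub>\<pi> \<delta>\<^sub>\<pi> \<longleftrightarrow>
     0 < \<epsilon>\<^sub>\<pi> \<and> \<epsilon>\<^sub>\<pi> < 1 \<and> 0 < \<delta>\<^sub>\<pi> \<and>
     (\<forall>\<epsilon>\<in>{0..1}. 0 \<le> \<pi> \<epsilon>) \<and> set_integrable lebesgue {0..1} \<pi> \<and>
     (\<forall>\<epsilon>\<in>{0<..<\<epsilon>\<^sub>\<pi>}. \<delta>\<^sub>\<pi> \<le> \<pi> \<epsilon>) \<and>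
     mono_on {0<..<\<epsilon>\<^sub>\<pi>} (\<lambda>\<epsilon>. \<epsilon> * \<pi> \<epsilon>)"

end

theory Submission
  imports Defs
begin

text \<open>Put \<open>r = S/A\<^sup>2\<close>. Since \<open>x\<^sub>i \<ge> -1\<close>, every \<open>\<epsilon> \<le> 2C/3\<close> satisfies
  \<open>ln (1 + \<epsilon> x\<^sub>i) \<ge> \<epsilon> x\<^sub>i - (1 + C) (\<epsilon> x\<^sub>i)\<^sup>2 / 2\<close>, so the product is at least
  \<open>exp (\<epsilon> S - (1 + C) \<epsilon>\<^sup>2 A\<^sup>2 / 2)\<close>. On the short interval from \<open>r\<close> to \<open>r (1 + \<surd>C / 4)\<close> this is
  still at least \<open>exp ((1 - 2 C) S\<^sup>2 / (2 A\<^sup>2))\<close>, while \<open>\<epsilon> \<pi> \<epsilon> \<ge> r \<pi> r\<close>; bounding the integral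
  below by this interval alone suffices.\<close>

text \<open>The difference \<open>f\<close> of the two sides vanishes at 0, and its derivative is
  \<open>s\<close> times a factor that is nonnegative for \<open>s \<ge> - e\<close>. Hence
  \<open>f\<close> falls up to 0 and rises afterwards, so 0 is its minimum on this range.\<close>

lemma ln_one_plus_quadratic_lower_bound:
  fixes t e :: real
  assumes "0 \<le> e" "e < 1" "- e \<le> t"
  shows "t - t\<^sup>2 / (2 * (1 - e)) \<le> ln (1 + t)"
proof -
  define f where "f = (\<lambda>s::real. ln (1 + s) - s + s\<^sup>2 / (2 * (1 - e)))"
  have deriv: "(f has_real_derivative s * (1 / (1 - e) - 1 / (1 + s))) (at s)" if "- e \<le> s" for s
    unfolding f_def using that assms
    by (auto intro!: derivative_eq_intros simp: divide_simps) (auto simp: algebra_simps)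
  have factor: "0 \<le> 1 / (1 - e) - 1 / (1 + s)" if "- e \<le> s" for s
    using that assms by (simp add: frac_le)
  have "f 0 \<le> f t"
  proof (cases "0 \<le> t")
    case True
    show ?thesis
      using True assms(1) by (intro DERIV_nonneg_imp_nondecreasing[of 0 t f])
        (force intro!: deriv mult_nonneg_nonneg factor)+
  next
    case False
    show ?thesis
      using False assms(3) by (intro DERIV_nonpos_imp_nonincreasing[of t 0 f])
        (force intro!: deriv mult_nonpos_nonneg factor)+
  qed
  then show ?thesis
    by (simp add: f_def)
qed

text \<open>One-sidedness gives \<open>\<epsilon> * x i \<ge> - e\<close>, so the logarithmic bound
  applies to every factor. Keeping \<open>e\<close> apart from \<epsilon> gives one quadratic
  coefficient valid for all \<epsilon> up to \<open>e\<close>.\<close>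

lemma exp_le_prod_one_plus:
  fixes x :: "nat \<Rightarrow> real" and \<epsilon> e :: real
  assumes "one_sided_path x" "0 \<le> \<epsilon>" "\<epsilon> \<le> e" "e < 1"
  shows "exp (\<epsilon> * S x n - \<epsilon>\<^sup>2 * (A x n)\<^sup>2 / (2 * (1 - e))) \<le> (\<Prod>i=1..n. 1 + \<epsilon> * x i)"
proof -
  have "(A x n)\<^sup>2 = (\<Sum>i=1..n. (x i)\<^sup>2)"
    unfolding A_def by (simp add: sum_nonneg)
  then have "\<epsilon> * S x n - \<epsilon>\<^sup>2 * (A x n)\<^sup>2 / (2 * (1 - e))
      = (\<Sum>i=1..n. \<epsilon> * x i - (\<epsilon> * x i)\<^sup>2 / (2 * (1 - e)))"
    by (simp add: S_def sum_subtractf sum_distrib_left sum_divide_distrib power_mult_distrib)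
  then have "exp (\<epsilon> * S x n - \<epsilon>\<^sup>2 * (A x n)\<^sup>2 / (2 * (1 - e)))
      = (\<Prod>i=1..n. exp (\<epsilon> * x i - (\<epsilon> * x i)\<^sup>2 / (2 * (1 - e))))"
    by (simp add: exp_sum)
  also have "\<dots> \<le> (\<Prod>i=1..n. 1 + \<epsilon> * x i)"
  proof (intro prod_mono conjI)
    fix i assume "i \<in> {1..n}"
    then have "-1 \<le> x i"
      using assms(1) by (auto simp: one_sided_path_def)
    then have t: "- e \<le> \<epsilon> * x i"
      using mult_left_mono[of "-1" "x i" \<epsilon>] assms(2,3) by linarith
    have "exp (\<epsilon> * x i - (\<epsilon> * x i)\<^sup>2 / (2 * (1 - e))) \<le> exp (ln (1 + \<epsilon> * x i))"
      using assms t by (simp only: exp_le_cancel_iff) (intro ln_one_plus_quadratic_lower_bound, auto)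
    then show "exp (\<epsilon> * x i - (\<epsilon> * x i)\<^sup>2 / (2 * (1 - e))) \<le> 1 + \<epsilon> * x i"
      using assms t by simp
  qed simp
  finally show ?thesis .
qed

text \<open>On the unit interval the product is continuous in \<epsilon> and bounded by
  \<open>?B\<close>, so the integrand is dominated by \<open>?B\<close> times the prior.\<close>

lemma set_integrable_bayes_capital:
  fixes x :: "nat \<Rightarrow> real" and \<pi> :: "real \<Rightarrow> real"
  assumes "set_integrable lebesgue {0..1} \<pi>"
  shows "set_integrable lebesgue {0..1} (\<lambda>\<epsilon>. (\<Prod>i=1..n. 1 + \<epsilon> * x i) * \<pi> \<epsilon>)"
proof -
  let ?P = "\<lambda>\<epsilon>::real. \<Prod>i=1..n. 1 + \<epsilon> * x i"
  let ?f = "\<lambda>\<epsilon>. indicator {0..1} \<epsilon> *\<^sub>R \<pi> \<epsilon>"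
  let ?B = "\<Prod>i=1..n. 1 + \<bar>x i\<bar>"
  have int: "integrable lebesgue ?f"
    using assms by (simp add: set_integrable_def)
  have "?P \<in> borel_measurable lebesgue"
    by (intro measurable_completion borel_measurable_continuous_onI continuous_intros) simp
  then have meas: "(\<lambda>\<epsilon>. ?P \<epsilon> * ?f \<epsilon>) \<in> borel_measurable lebesgue"
    using borel_measurable_integrable[OF int] by (intro borel_measurable_times)
  have bound: "\<bar>?P \<epsilon>\<bar> \<le> ?B" if "\<epsilon> \<in> {0..1}" for \<epsilon>
    unfolding abs_prod
  proof (intro prod_mono conjI)
    fix i
    have "\<bar>\<epsilon> * x i\<bar> \<le> \<bar>x i\<bar>"
      using that by (simp add: abs_mult mult_left_le_one_le)
    then show "\<bar>1 + \<epsilon> * x i\<bar> \<le> 1 + \<bar>x i\<bar>"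
      by linarith
  qed simp
  have "integrable lebesgue (\<lambda>\<epsilon>. ?P \<epsilon> * ?f \<epsilon>)"
  proof (rule Bochner_Integration.integrable_bound[OF integrable_mult_right[OF int, of ?B] meas])
    show "AE \<epsilon> in lebesgue. norm (?P \<epsilon> * ?f \<epsilon>) \<le> norm (?B * ?f \<epsilon>)"
    proof (rule AE_I2)
      fix \<epsilon> :: real
      show "norm (?P \<epsilon> * ?f \<epsilon>) \<le> norm (?B * ?f \<epsilon>)"
      proof (cases "\<epsilon> \<in> {0..1}")
        case True
        then show ?thesis
          unfolding real_norm_def abs_mult
          by (intro mult_right_mono order.trans[OF bound[OF True] abs_ge_self]) auto
      qed simp
    qed
  qed
  then show ?thesis
    by (simp add: set_integrable_def mult.left_commute)
qed

lemma const_mult_length_le_set_integral: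
  fixes f :: "real \<Rightarrow> real"
  assumes "set_integrable lebesgue {0..1} f" "\<And>\<epsilon>. \<epsilon> \<in> {0..1} \<Longrightarrow> 0 \<le> f \<epsilon>"
    and "0 \<le> a" "a \<le> b" "b \<le> 1" "\<And>\<epsilon>. \<epsilon> \<in> {a..b} \<Longrightarrow> c \<le> f \<epsilon>"
  shows "c * (b - a) \<le> (LINT \<epsilon>:{0..1}|lebesgue. f \<epsilon>)"
proof -
  have "c * (b - a) = (LINT \<epsilon>|lebesgue. c * indicator {a..b} \<epsilon>)"
    using assms(4) by simp
  also have "\<dots> \<le> (LINT \<epsilon>:{0..1}|lebesgue. f \<epsilon>)"
    unfolding set_lebesgue_integral_def
  proof (rule integral_mono)
    show "integrable lebesgue (\<lambda>\<epsilon>. c * indicator {a..b} \<epsilon>)"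
      by (intro integrable_mult_right integrable_real_indicator) (auto simp: emeasure_lborel_Icc_eq)
    show "integrable lebesgue (\<lambda>\<epsilon>. indicator {0..1} \<epsilon> *\<^sub>R f \<epsilon>)"
      using assms(1) by (simp add: set_integrable_def)
    show "c * indicator {a..b} \<epsilon> \<le> indicator {0..1} \<epsilon> *\<^sub>R f \<epsilon>" for \<epsilon>
      using assms(2)[of \<epsilon>] assms(3,5) assms(6)[of \<epsilon>] by (auto simp: indicator_def)
  qed
  finally show ?thesis .
qed

text \<open>This is the exponent at \<open>\<epsilon> = r * (1 + v)\<close>, divided by
  \<open>r\<^sup>2 * (A x n)\<^sup>2\<close>. At \<open>v = 0\<close> it exceeds the target by
  \<open>C / 2\<close>. Since \<open>r\<close> nearly maximises it, the linear loss is only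
  \<open>C * v \<le> C / 4\<close>; the quadratic loss is at most
  \<open>v\<^sup>2 \<le> C / 16\<close>, which explains the scale \<open>sqrt C\<close> for
  \<open>v\<close>.\<close>

lemma quadratic_exponent_lower_bound:
  fixes C v :: real
  assumes "0 < C" "C < 1/2" "0 \<le> v" "v \<le> sqrt C / 4"
  shows "(1 - 2 * C) / 2 \<le> (1 + v) - (1 + C) * (1 + v)\<^sup>2 / 2"
proof -
  have expand: "(1 + v) - (1 + C) * (1 + v)\<^sup>2 / 2 = (1 - C) / 2 - C * v - (1 + C) * v\<^sup>2 / 2"
    by (simp add: power2_eq_square field_simps)
  have "sqrt C \<le> 1"
    using assms by simp
  then have "v \<le> 1 / 4"
    using assms(4) by linarith
  then have "C * v \<le> C * (1 / 4)"
    using assms(1) by (intro mult_left_mono) auto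
  moreover have "v\<^sup>2 \<le> C / 16"
    using power_mono[OF assms(4,3), of 2] assms(1) by (simp add: power_divide)
  moreover have "(1 + C) * v\<^sup>2 \<le> 2 * v\<^sup>2"
    using assms by (intro mult_right_mono) auto
  ultimately have "(1 - 2 * C) / 2 \<le> (1 - C) / 2 - C * v - (1 + C) * v\<^sup>2 / 2"
    using assms(1) by argo
  then show ?thesis
    by (simp only: expand)
qed

theorem theorem4p1:
  fixes \<pi> :: "real \<Rightarrow> real" and \<epsilon>\<^sub>\<pi> \<delta>\<^sub>\<pi> C :: real
    and x :: "nat \<Rightarrow> real" and n :: nat
  assumes "regular_prior \<pi> \<epsilon>\<^sub>\<pi> \<delta>\<^sub>\<pi>"
    and "one_sided_path x"
    and "C \<in> {0<..<min \<epsilon>\<^sub>\<pi> (1/2)}"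
    and "0 < S x n / (A x n)\<^sup>2" and "S x n / (A x n)\<^sup>2 < C / 2"
  shows "bayes_capital \<pi> x n \<ge>
    sqrt C / 6 * (S x n / (A x n)\<^sup>2) * \<pi> (S x n / (A x n)\<^sup>2)
      * exp ((1 - 2 * C) * (S x n)\<^sup>2 / (2 * (A x n)\<^sup>2))"
proof -
  define r where "r = S x n / (A x n)\<^sup>2"
  define h where "h = sqrt C / 4"
  define E where "E = exp ((1 - 2 * C) * (S x n)\<^sup>2 / (2 * (A x n)\<^sup>2))"
  \<comment> \<open>Lower bound for the integrand on \<open>{r..r * (1 + h)}\<close>: prior bound
    times product bound.\<close>
  define c where "c = \<pi> r / (1 + h) * E"
  have C: "0 < C" "C < \<epsilon>\<^sub>\<pi>" "C < 1/2"
    using assms(3) by auto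
  have r: "0 < r" "r < C / 2"
    using assms(4,5) by (auto simp: r_def)
  \<comment> \<open>Division by zero yields 0, so a positive quotient rules out
    \<open>A x n = 0\<close>.\<close>
  have A0: "(A x n)\<^sup>2 \<noteq> 0"
    using assms(4) by force
  then have S: "S x n = r * (A x n)\<^sup>2"
    by (simp add: r_def)
  have eps: "\<epsilon>\<^sub>\<pi> < 1"
    and pi0: "\<And>\<epsilon>. \<epsilon> \<in> {0..1} \<Longrightarrow> 0 \<le> \<pi> \<epsilon>"
    and int: "set_integrable lebesgue {0..1} \<pi>"
    and mono: "mono_on {0<..<\<epsilon>\<^sub>\<pi>} (\<lambda>\<epsilon>. \<epsilon> * \<pi> \<epsilon>)"
    using assms(1) by (auto simp: regular_prior_def)
  have pr: "0 \<le> \<pi> r"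
    using r C by (intro pi0) auto
  have "sqrt C \<le> 1"
    using C by simp
  then have h: "0 < h" "h \<le> 1/4"
    using C by (auto simp: h_def)
  \<comment> \<open>The product is below \<open>5 * C / 8\<close>; the rounder
    \<open>2 * C / 3\<close> serves as \<open>e\<close> in the product bound and also keeps the
    interval below \<open>\<epsilon>\<^sub>\<pi>\<close>.\<close>
  have upper: "r * (1 + h) \<le> 2 * C / 3"
    using mult_mono[of r "C/2" "1 + h" "5/4"] r h C by simp
  have E_eq: "E = exp ((r\<^sup>2 * (A x n)\<^sup>2) * ((1 - 2 * C) / 2))"
    using A0 by (simp add: E_def S power2_eq_square)
  have prod_ge: "E \<le> (\<Prod>i=1..n. 1 + \<epsilon> * x i)" if "\<epsilon> \<in> {r..r * (1 + h)}" for \<epsilon>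
  proof -
    define v where "v = \<epsilon> / r - 1"
    have \<epsilon>: "\<epsilon> = r * (1 + v)"
      using r by (simp add: v_def)
    have v: "0 \<le> v" "v \<le> sqrt C / 4"
      using that r by (auto simp: v_def h_def field_simps)
    \<comment> \<open>Indeed \<open>(1 + C) * (1 - 2 * C / 3) - 1 = C * (1 - 2 * C) / 3\<close>,
      which is positive for \<open>C < 1/2\<close>.\<close>
    have "1 / (1 - 2 * C / 3) \<le> 1 + C"
      using C mult_left_mono[of C "1/2" C] by (simp add: field_simps)
    then have "(1 + v)\<^sup>2 / 2 * (1 / (1 - 2 * C / 3)) \<le> (1 + v)\<^sup>2 / 2 * (1 + C)"
      by (intro mult_left_mono) auto
    then have "(1 - 2 * C) / 2 \<le> (1 + v) - (1 + v)\<^sup>2 / 2 * (1 / (1 - 2 * C / 3))"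
      using quadratic_exponent_lower_bound[OF C(1,3) v] by (simp only: mult.commute times_divide_eq_left)
    then have "(r\<^sup>2 * (A x n)\<^sup>2) * ((1 - 2 * C) / 2)
        \<le> (r\<^sup>2 * (A x n)\<^sup>2) * ((1 + v) - (1 + v)\<^sup>2 / 2 * (1 / (1 - 2 * C / 3)))"
      by (intro mult_left_mono) auto
    also have "\<dots> = \<epsilon> * S x n - \<epsilon>\<^sup>2 * (A x n)\<^sup>2 / (2 * (1 - 2 * C / 3))"
      unfolding S \<epsilon> power_mult_distrib right_diff_distrib
      by (simp add: power2_eq_square)
    finally have "E \<le> exp (\<epsilon> * S x n - \<epsilon>\<^sup>2 * (A x n)\<^sup>2 / (2 * (1 - 2 * C / 3)))"
      by (simp add: E_eq)
    also have "\<dots> \<le> (\<Prod>i=1..n. 1 + \<epsilon> * x i)"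
      using that upper r C by (intro exp_le_prod_one_plus assms(2)) auto
    finally show ?thesis .
  qed
  \<comment> \<open>The prior itself may decrease, but monotonicity of
    \<open>\<epsilon> * \<pi> \<epsilon>\<close> limits the drop to the ratio
    \<open>\<epsilon> / r \<le> 1 + h\<close>.\<close>
  have pi_ge: "\<pi> r / (1 + h) \<le> \<pi> \<epsilon>" if "\<epsilon> \<in> {r..r * (1 + h)}" for \<epsilon>
  proof -
    have \<epsilon>: "0 < \<epsilon>" "r \<le> \<epsilon>" "\<epsilon> \<le> r * (1 + h)" "\<epsilon> < \<epsilon>\<^sub>\<pi>"
      using that r upper C by auto
    have "r * \<pi> r \<le> \<epsilon> * \<pi> \<epsilon>"
      using \<epsilon> r C by (intro mono_onD[OF mono]) auto
    also have "\<dots> \<le> (r * (1 + h)) * \<pi> \<epsilon>"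
      using \<epsilon> eps by (intro mult_right_mono pi0) auto
    finally have "\<pi> r \<le> (1 + h) * \<pi> \<epsilon>"
      using r(1) by (simp add: mult.assoc)
    then show ?thesis
      using h by (simp add: field_simps)
  qed
  \<comment> \<open>The interval has length \<open>r * h\<close> and the prior loses a factor
    \<open>1 + h\<close>; the constant 6 comes from \<open>h = sqrt C / 4\<close> and
    \<open>1 + h \<le> 3 / 2\<close>.\<close>
  have "sqrt C / 6 = h / (3 / 2)"
    by (simp add: h_def)
  also have "\<dots> \<le> h / (1 + h)"
    using h by (intro divide_left_mono) auto
  finally have "sqrt C / 6 \<le> h / (1 + h)" .
  then have "sqrt C / 6 * (r * \<pi> r * E) \<le> h / (1 + h) * (r * \<pi> r * E)"
    using r pr by (intro mult_right_mono) (auto simp: E_def)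
  also have "\<dots> = c * (r * (1 + h) - r)"
    by (simp add: c_def algebra_simps)
  also have "\<dots> \<le> bayes_capital \<pi> x n"
    unfolding bayes_capital_def
  proof (rule const_mult_length_le_set_integral)
    show "set_integrable lebesgue {0..1} (\<lambda>\<epsilon>. (\<Prod>i=1..n. 1 + \<epsilon> * x i) * \<pi> \<epsilon>)"
      by (rule set_integrable_bayes_capital[OF int])
    \<comment> \<open>Nonnegativity on the whole unit interval allows the mass outside the short
      interval to be dropped.\<close>
    show "0 \<le> (\<Prod>i=1..n. 1 + \<epsilon> * x i) * \<pi> \<epsilon>" if "\<epsilon> \<in> {0..1}" for \<epsilon>
    proof (intro mult_nonneg_nonneg prod_nonneg pi0 that)
      fix i assume "i \<in> {1..n}"
      then have "-1 \<le> x i"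
        using assms(2) by (auto simp: one_sided_path_def)
      then show "0 \<le> 1 + \<epsilon> * x i"
        using that mult_left_mono[of "-1" "x i" \<epsilon>] by auto
    qed
    show "c \<le> (\<Prod>i=1..n. 1 + \<epsilon> * x i) * \<pi> \<epsilon>" if "\<epsilon> \<in> {r..r * (1 + h)}" for \<epsilon>
    proof -
      have "0 \<le> E" "0 \<le> \<pi> r / (1 + h)"
        using pr h by (auto simp: E_def)
      then have "E * (\<pi> r / (1 + h)) \<le> (\<Prod>i=1..n. 1 + \<epsilon> * x i) * \<pi> \<epsilon>"
        using prod_ge[OF that] pi_ge[OF that] by (intro mult_mono) auto
      then show ?thesis
        by (simp add: c_def mult.commute)
    qed
  qed (use r h upper C in auto)
  finally show ?thesis
    by (simp add: r_def E_def mult.assoc)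
qed

end
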